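(* For every $p\ge1$ and $\sigma>0$ there is a constant $C_0>0$, depending only on $p$ and $\sigma$, such that the following holds. Let $f:\mathbb{R}\to\mathbb{R}$ be $C^1$, even and bounded, with $f(0)=0$ and $f'(x)\ge0$ for $x>0$. Then $$-\int_0^1\frac{Hf(x)\,f'(x)\,f(x)^{p-1}}{x^\sigma}\,dx\ \ge\ C_0\int_0^1\frac{f(x)^{p+1}}{x^{1+\sigma}}\,dx.$$ If the right-hand side is infinite, the inequality is understood in the sense that the left-hand side must also be infinite.
   Context: $Hf$ is the Hilbert transform, $Hf(x)=\mathrm{P.V.}\,\frac1\pi\int_{\mathbb{R}}\frac{f(y)}{x-y}\,dy$, with the principal value taken at the singularity $y=x$ and symmetrically at infinity. *)

theory Defs
  imports "HOL-Analysis.Analysis"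
begin

text \<open>The truncation \<open>\<epsilon> < \<bar>x - y\<bar>\<close> is symmetric about the singularity \<open>y = x\<close>, the truncation
  \<open>\<bar>y\<bar> < R\<close> is symmetric at infinity; the limit is the joint one, \<open>\<epsilon> \<rightarrow> 0+\<close> and \<open>R \<rightarrow> \<infinity>\<close>.\<close>

definition hilbert_transform :: "(real \<Rightarrow> real) \<Rightarrow> real \<Rightarrow> real" where
  "hilbert_transform f x =
     Lim (at_right 0 \<times>\<^sub>F at_top)
       (\<lambda>(\<epsilon>, R). 1 / pi * (LBINT y:{y. \<epsilon> < \<bar>x - y\<bar> \<and> \<bar>y\<bar> < R}. f y / (x - y)))"

text \<open>The Lebesgue integral over \<open>A\<close> with values in the extended reals, i.e. the integral of the
  positive part minus that of the negative part. Unlike the Bochner integral, which is \<open>0\<close> for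
  non-integrable functions, it records infinite values. In the undefined case
  \<open>\<infinity> - \<infinity>\<close> its value is \<open>\<infinity>\<close>.\<close>

definition ext_integral :: "real set \<Rightarrow> (real \<Rightarrow> real) \<Rightarrow> ereal" where
  "ext_integral A g =
     enn2ereal (\<integral>\<^sup>+x\<in>A. ennreal (g x) \<partial>lborel) - enn2ereal (\<integral>\<^sup>+x\<in>A. ennreal (- g x) \<partial>lborel)"

end

theory Submission imports Defs begin

text \<open>Write \<open>d x = f x - f (x / 2)\<close>. Since \<open>f\<close> is even and the principal value of
  \<open>2 x / (x\<^sup>2 - y\<^sup>2)\<close> over \<open>y > 0\<close> vanishes, \<open>- \<pi> Hf(x)\<close> is the integral over \<open>y > 0\<close> of
  \<open>2 x (f y - f x) / (y\<^sup>2 - x\<^sup>2)\<close>, which is nonnegative by monotonicity; its part over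
  \<open>y < x / 2\<close> alone is at least \<open>d x\<close>. For \<open>x / 2 \<le> y \<le> x\<close> we have
  \<open>d y \<ge> f y - f (x / 2)\<close>, so the integral of \<open>d f' f\<^bsup>p-1\<^esup>\<close> over \<open>[x / 2, x]\<close> is at least
  \<open>(d x)\<^bsup>p+1\<^esup> / (p + 1)\<close>, and integrating this against \<open>x\<^bsup>-1-\<sigma>\<^esup>\<close> bounds the left-hand side
  below by a multiple of the integral of \<open>d\<^bsup>p+1\<^esup> / x\<^bsup>1+\<sigma>\<^esup>\<close>. A dyadic Hardy inequality, from
  \<open>f x = (\<Sum>n. d (x / 2^n))\<close>, replaces \<open>d\<close> by \<open>f\<close>; no finiteness is needed at any point.\<close>

section \<open>A dyadic Hardy inequality\<close>


text \<open>The weights \<open>\<mu>\<^sup>n (1 - \<mu>) / 2\<close> sum to \<open>1 / 2\<close>, so the telescoping sum for \<open>f x\<close> cannot have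
  every term below its weight times \<open>f x\<close>.\<close>

lemma dyadic_hardy_pointwise:
  fixes f :: "real \<Rightarrow> real" and q \<mu> x :: real
  assumes lim: "(\<lambda>n. f (x / 2 ^ n)) \<longlonglongrightarrow> 0"
    and mono: "\<And>n. f (x / 2 ^ Suc n) \<le> f (x / 2 ^ n)"
    and "0 < \<mu>" "\<mu> < 1" "q > 0"
  shows "\<exists>n. f x powr q \<le> ((f (x / 2 ^ n) - f (x / 2 ^ Suc n)) / (\<mu> ^ n * ((1 - \<mu>) / 2))) powr q"
proof (rule ccontr)
  define d where "d n = f (x / 2 ^ n) - f (x / 2 ^ Suc n)" for n
  define w where "w n = \<mu> ^ n * ((1 - \<mu>) / 2)" for n
  have w0: "w n > 0" for n using assms by (simp add: w_def)
  have d0: "d n \<ge> 0" for n using mono[of n] by (simp add: d_def)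
  assume "\<not> ?thesis"
  then have neg: "(d n / w n) powr q < f x powr q" for n
    unfolding d_def w_def by (simp add: not_le)
  have "decseq (\<lambda>n. f (x / 2 ^ n))"
    using mono by (intro decseq_SucI) auto
  then have "f x \<ge> 0"
    using decseq_ge[OF _ lim, of 0] by simp
  \<comment> \<open>If \<open>f x = 0\<close>, the right side of \<open>neg\<close> is
    \<open>0 powr q = 0\<close>, and no power lies strictly below it.\<close>
  moreover have "f x \<noteq> 0"
    using neg[of 0] by (auto simp: not_less[symmetric])
  ultimately have fx: "f x > 0" by simp
  have le: "d n \<le> w n * f x" for n
  proof (rule ccontr)
    assume "\<not> ?thesis"
    then have "f x \<le> d n / w n"
      using w0[of n] by (simp add: field_simps)
    then have "f x powr q \<le> (d n / w n) powr q"
      using fx \<open>q > 0\<close> by (intro powr_mono2) auto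
    with neg[of n] show False by simp
  qed
  have sd: "d sums (f x)"
    using telescope_sums'[OF lim] by (simp add: d_def[abs_def])
  have "(\<lambda>n. \<mu> ^ n * ((1 - \<mu>) / 2)) sums (1 / (1 - \<mu>) * ((1 - \<mu>) / 2))"
    using assms by (intro sums_mult2 geometric_sums) auto
  then have sw: "w sums (1 / 2)"
    using assms by (simp add: w_def[abs_def])
  have "f x \<le> 1 / 2 * f x"
    using sums_le[OF le sd sums_mult2[OF sw]] .
  with fx show False by simp
qed

text \<open>Substitute \<open>u = x / 2 ^ n\<close>: the measure contributes \<open>2 ^ n\<close>
  and the weight \<open>2 powr (- n * (1 + \<sigma>))\<close>, together
  \<open>2 powr (- n * \<sigma>)\<close>. The variable \<open>u\<close> stays below
  \<open>1 / 2 ^ n\<close>; enlarging its range to the whole unit interval gives the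
  inequality.\<close>

lemma nn_integral_dyadic_scale_le:
  fixes d :: "real \<Rightarrow> real" and q \<sigma> :: real
  assumes [measurable]: "d \<in> borel_measurable borel"
  shows "(\<integral>\<^sup>+x\<in>{0<..<1}. ennreal (d (x / 2 ^ n) powr q / x powr (1 + \<sigma>)) \<partial>lborel)
    \<le> ennreal (2 powr (- real n * \<sigma>)) * (\<integral>\<^sup>+x\<in>{0<..<1}. ennreal (d x powr q / x powr (1 + \<sigma>)) \<partial>lborel)"
proof -
  define g where "g x = ennreal (d x powr q / x powr (1 + \<sigma>)) * indicator {0<..<1} x" for x
  have [measurable]: "g \<in> borel_measurable borel"
    unfolding g_def by measurable
  have "(\<integral>\<^sup>+x\<in>{0<..<1}. ennreal (d (x / 2 ^ n) powr q / x powr (1 + \<sigma>)) \<partial>lborel)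
    \<le> (\<integral>\<^sup>+x. ennreal (2 powr (- real n * (1 + \<sigma>))) * g (0 + (1 / 2 ^ n) * x) \<partial>lborel)"
  proof (rule nn_integral_mono)
    fix x :: real
    show "ennreal (d (x / 2 ^ n) powr q / x powr (1 + \<sigma>)) * indicator {0<..<1} x
      \<le> ennreal (2 powr (- real n * (1 + \<sigma>))) * g (0 + (1 / 2 ^ n) * x)"
    proof (cases "x \<in> {0<..<1}")
      case True
      then have x: "x / 2 ^ n \<in> {0<..<1}"
        using one_le_power[of "2::real" n] by (auto simp: field_simps simp del: one_le_power)
      have "(x / 2 ^ n) powr (1 + \<sigma>) = x powr (1 + \<sigma>) * 2 powr (- real n * (1 + \<sigma>))"
        using True by (simp add: powr_divide powr_minus_divide powr_powr flip: powr_realpow)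
      then have "d (x / 2 ^ n) powr q / x powr (1 + \<sigma>)
          = 2 powr (- real n * (1 + \<sigma>)) * (d (x / 2 ^ n) powr q / (x / 2 ^ n) powr (1 + \<sigma>))"
        using True by (simp add: field_simps)
      then show ?thesis
        using True x by (simp add: g_def flip: ennreal_mult')
    qed simp
  qed
  also have "\<dots> = ennreal (2 powr (- real n * (1 + \<sigma>))) * (\<integral>\<^sup>+x. g (0 + (1 / 2 ^ n) * x) \<partial>lborel)"
    by (intro nn_integral_cmult) measurable
  also have "2 powr (- real n * (1 + \<sigma>)) = 2 powr (- real n * \<sigma>) * \<bar>1 / 2 ^ n\<bar>"
    by (simp add: ring_distribs powr_diff powr_minus_divide powr_realpow)
  also have "ennreal \<dots> * (\<integral>\<^sup>+x. g (0 + (1 / 2 ^ n) * x) \<partial>lborel)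
     = ennreal (2 powr (- real n * \<sigma>)) * (ennreal \<bar>1 / 2 ^ n\<bar> * (\<integral>\<^sup>+x. g (0 + (1 / 2 ^ n) * x) \<partial>lborel))"
    by (subst ennreal_mult) (simp_all only: mult.assoc powr_ge_zero abs_ge_zero)
  also have "ennreal \<bar>1 / 2 ^ n\<bar> * (\<integral>\<^sup>+x. g (0 + (1 / 2 ^ n) * x) \<partial>lborel) = integral\<^sup>N lborel g"
    by (rule nn_integral_real_affine[symmetric]) auto
  finally show ?thesis unfolding g_def .
qed

text \<open>The index supplied by the pointwise lemma depends on \<open>x\<close>, so it is replaced
  by the sum over all \<open>n\<close>. Term \<open>n\<close> loses
  \<open>\<mu> powr (- n * q)\<close> through the weights and gains
  \<open>2 powr (- n * \<sigma>)\<close> through scaling. The order of quantifiers records that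
  \<open>K\<close> is uniform in \<open>f\<close>; both integrals may be infinite.\<close>

lemma dyadic_hardy_inequality:
  fixes q \<sigma> :: real
  assumes "q > 0" "\<sigma> > 0"
  shows "\<exists>K>0. \<forall>f::real \<Rightarrow> real. f \<in> borel_measurable borel \<longrightarrow> mono_on {0..} f \<longrightarrow> isCont f 0 \<longrightarrow> f 0 = 0 \<longrightarrow>
    (\<integral>\<^sup>+x\<in>{0<..<1}. ennreal (f x powr q / x powr (1 + \<sigma>)) \<partial>lborel)
    \<le> ennreal K * (\<integral>\<^sup>+x\<in>{0<..<1}. ennreal ((f x - f (x / 2)) powr q / x powr (1 + \<sigma>)) \<partial>lborel)"
proof -
  \<comment> \<open>This choice gives \<open>\<mu> powr q = r\<close>, where \<open>r\<close> is the
    square root of the scaling gain \<open>2 powr (- \<sigma>)\<close>. Half of the gain pays for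
    the weights, and the other half leaves a geometric series of ratio \<open>r < 1\<close>.\<close>
  define \<mu> where "\<mu> = (2::real) powr (- \<sigma> / (2 * q))"
  define r where "r = (2::real) powr (- \<sigma> / 2)"
  define c where "c = (2 / (1 - \<mu>)) powr q"
  have lam: "0 < \<mu>" "\<mu> < 1"
    using assms by (auto simp: \<mu>_def powr_less_one intro!: powr_less_one)
  have r: "0 < r" "r < 1"
    using assms by (auto simp: r_def intro!: powr_less_one)
  have c: "c > 0" using lam by (simp add: c_def)
  have wq: "(1 / (\<mu> ^ n * ((1 - \<mu>) / 2))) powr q * 2 powr (- real n * \<sigma>) = c * r ^ n" for n
  proof -
    have "\<mu> powr q = r"
      using assms by (simp add: \<mu>_def r_def powr_powr)
    then have "(\<mu> ^ n) powr q = r ^ n"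
      using lam by (metis powr_realpow powr_powr mult.commute r(1))
    moreover have "2 powr (- real n * \<sigma>) = r ^ n * r ^ n"
      using r(1) by (simp add: r_def powr_powr mult.commute flip: powr_realpow powr_add)
    moreover have "(1 / (\<mu> ^ n * ((1 - \<mu>) / 2))) powr q = c / (\<mu> ^ n) powr q"
      using lam by (simp add: c_def powr_divide powr_mult)
    ultimately show ?thesis using r by simp
  qed
  show ?thesis
  proof (intro exI[of _ "c / (1 - r)"] conjI allI impI)
    show "c / (1 - r) > 0" using c r by simp
    fix f :: "real \<Rightarrow> real"
    assume [measurable]: "f \<in> borel_measurable borel" and mono: "mono_on {0..} f"
      and cont: "isCont f 0" and f0: "f 0 = 0"
    define d where "d x = f x - f (x / 2)" for x
    have [measurable]: "d \<in> borel_measurable borel" unfolding d_def by measurable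
    define W where "W n = (1 / (\<mu> ^ n * ((1 - \<mu>) / 2))) powr q" for n :: nat
    define J where "J = (\<integral>\<^sup>+x\<in>{0<..<1}. ennreal (d x powr q / x powr (1 + \<sigma>)) \<partial>lborel)"
    have "(\<integral>\<^sup>+x\<in>{0<..<1}. ennreal (f x powr q / x powr (1 + \<sigma>)) \<partial>lborel)
      \<le> (\<integral>\<^sup>+x. (\<Sum>n. ennreal (W n) * (ennreal (d (x / 2 ^ n) powr q / x powr (1 + \<sigma>)) * indicator {0<..<1} x)) \<partial>lborel)"
    proof (rule nn_integral_mono)
      fix x :: real
      show "ennreal (f x powr q / x powr (1 + \<sigma>)) * indicator {0<..<1} x
        \<le> (\<Sum>n. ennreal (W n) * (ennreal (d (x / 2 ^ n) powr q / x powr (1 + \<sigma>)) * indicator {0<..<1} x))"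
        (is "_ \<le> (\<Sum>n. ?t n)")
      proof (cases "x \<in> {0<..<1}")
        case True
        have "(\<lambda>n. f (x / 2 ^ n)) \<longlonglongrightarrow> 0"
        proof -
          have "(\<lambda>n. x * (1 / 2) ^ n) \<longlonglongrightarrow> x * 0"
            by (intro tendsto_intros LIMSEQ_power_zero) auto
          then have "(\<lambda>n. x / 2 ^ n) \<longlonglongrightarrow> 0"
            by (simp add: power_divide)
          from isCont_tendsto_compose[OF cont this] show ?thesis by (simp add: f0)
        qed
        moreover have dn: "f (x / 2 ^ Suc n) \<le> f (x / 2 ^ n)" for n
          using True by (intro mono_onD[OF mono]) (auto simp: field_simps)
        ultimately obtain n where
          "f x powr q \<le> ((f (x / 2 ^ n) - f (x / 2 ^ Suc n)) / (\<mu> ^ n * ((1 - \<mu>) / 2))) powr q"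
          using dyadic_hardy_pointwise[of f x \<mu> q] lam \<open>q > 0\<close> by blast
        also have "\<dots> = W n * d (x / 2 ^ n) powr q"
          using powr_mult[of "1 / (\<mu> ^ n * ((1 - \<mu>) / 2))" "d (x / 2 ^ n)" q] dn[of n] lam
          by (simp add: W_def d_def mult.commute)
        finally have "f x powr q / x powr (1 + \<sigma>) \<le> W n * (d (x / 2 ^ n) powr q / x powr (1 + \<sigma>))"
          by (simp add: divide_right_mono)
        then have "ennreal (f x powr q / x powr (1 + \<sigma>)) \<le> ?t n"
          using True by (simp add: W_def ennreal_leI flip: ennreal_mult')
        also have "?t n \<le> (\<Sum>n. ?t n)"
          using sum_le_suminf[OF summableI, of "{n}" ?t] by simp
        finally show ?thesis using True by simp
      qed simp
    qed
    also have "\<dots> = (\<Sum>n. \<integral>\<^sup>+x. ennreal (W n) * (ennreal (d (x / 2 ^ n) powr q / x powr (1 + \<sigma>)) * indicator {0<..<1} x) \<partial>lborel)"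
      by (rule nn_integral_suminf) measurable
    also have "\<dots> \<le> (\<Sum>n. ennreal (c * r ^ n) * J)"
    proof (intro suminf_le summableI)
      fix n
      have "(\<integral>\<^sup>+x. ennreal (W n) * (ennreal (d (x / 2 ^ n) powr q / x powr (1 + \<sigma>)) * indicator {0<..<1} x) \<partial>lborel)
        = ennreal (W n) * (\<integral>\<^sup>+x\<in>{0<..<1}. ennreal (d (x / 2 ^ n) powr q / x powr (1 + \<sigma>)) \<partial>lborel)"
        by (rule nn_integral_cmult) measurable
      also have "\<dots> \<le> ennreal (W n) * (ennreal (2 powr (- real n * \<sigma>)) * J)"
        unfolding J_def by (intro mult_left_mono nn_integral_dyadic_scale_le) auto
      also have "\<dots> = ennreal (c * r ^ n) * J"
        by (simp add: W_def flip: wq mult.assoc ennreal_mult')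
      finally show "(\<integral>\<^sup>+x. ennreal (W n) * (ennreal (d (x / 2 ^ n) powr q / x powr (1 + \<sigma>)) * indicator {0<..<1} x) \<partial>lborel)
        \<le> ennreal (c * r ^ n) * J" .
    qed
    also have "\<dots> = (\<Sum>n. ennreal (c * r ^ n)) * J"
      by simp
    also have "(\<Sum>n. ennreal (c * r ^ n)) = ennreal (c / (1 - r))"
    proof (rule suminf_ennreal_eq)
      show "(\<lambda>n. c * r ^ n) sums (c / (1 - r))"
        using sums_mult[OF geometric_sums, of r c] r by simp
    qed (use c r in auto)
    finally show "(\<integral>\<^sup>+x\<in>{0<..<1}. ennreal (f x powr q / x powr (1 + \<sigma>)) \<partial>lborel)
      \<le> ennreal (c / (1 - r)) * (\<integral>\<^sup>+x\<in>{0<..<1}. ennreal ((f x - f (x / 2)) powr q / x powr (1 + \<sigma>)) \<partial>lborel)"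
      unfolding J_def d_def .
  qed
qed

section \<open>Bounding dyadic increments by the weighted derivative\<close>

text \<open>Taking the positive part makes the power differentiable on the whole line: at
  \<open>0\<close> the difference quotient is at most \<open>\<bar>h\<bar> powr (a - 1)\<close>,
  which tends to \<open>0\<close> because \<open>a > 1\<close>.\<close>

lemma DERIV_max_powr:
  fixes a z :: real
  assumes "a > 1"
  shows "((\<lambda>z. max 0 z powr a) has_real_derivative a * max 0 z powr (a - 1)) (at z)"
proof -
  consider "z < 0" | "z = 0" | "z > 0" by linarith
  then show ?thesis
  proof cases
    case 1
    then have "((\<lambda>z. max 0 z powr a) has_real_derivative 0) (at z)
        \<longleftrightarrow> ((\<lambda>z. 0) has_real_derivative 0) (at z)"
      by (intro DERIV_cong_ev refl eventually_mono[OF eventually_nhds_in_open[of "{..<0}"]])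
         auto
    then show ?thesis using 1 by simp
  next
    case 2
    have "((\<lambda>h. max 0 h powr a / h) \<longlongrightarrow> 0) (at 0)"
    proof (rule Lim_null_comparison)
      show "\<forall>\<^sub>F h in at 0. norm (max 0 h powr a / h) \<le> \<bar>h\<bar> powr (a - 1)"
        by (rule always_eventually) (auto simp: max_def powr_diff intro!: divide_nonneg_neg)
      have "((\<lambda>h::real. \<bar>h\<bar> powr (a - 1)) \<longlongrightarrow> \<bar>0\<bar> powr (a - 1)) (at 0)"
        using assms by (intro tendsto_powr' tendsto_intros) auto
      then show "((\<lambda>h::real. \<bar>h\<bar> powr (a - 1)) \<longlongrightarrow> 0) (at 0)" by simp
    qed
    then show ?thesis using 2 assms by (simp add: DERIV_def)
  next
    case 3
    then have "((\<lambda>z. max 0 z powr a) has_real_derivative a * z powr (a - 1)) (at z)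
        \<longleftrightarrow> ((\<lambda>z. z powr a) has_real_derivative a * z powr (a - 1)) (at z)"
      by (intro DERIV_cong_ev refl eventually_mono[OF eventually_nhds_in_open[of "{0<..}"]])
         auto
    then show ?thesis using 3 has_real_derivative_powr[of z a] by simp
  qed
qed

text \<open>With \<open>c = f (x / 2)\<close>, the function \<open>(f - c) powr p * f'\<close> has
  the antiderivative \<open>(f - c) powr (p + 1) / (p + 1)\<close>, which vanishes at
  \<open>x / 2\<close>. The integrand on the right dominates this function times
  \<open>1 / x powr \<sigma>\<close>.\<close>

lemma powr_increment_le_nn_integral:
  fixes f :: "real \<Rightarrow> real" and p \<sigma> x :: real
  assumes "p \<ge> 1" "\<sigma> > 0" "x > 0"
    and der: "\<And>y. (f has_real_derivative f' y) (at y)"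
    and nonneg: "\<And>y. y > 0 \<Longrightarrow> f' y \<ge> 0"
    and mono: "mono_on {0..} f" and f0: "f 0 = 0"
    and [measurable]: "f' \<in> borel_measurable borel"
  shows "ennreal ((f x - f (x / 2)) powr (p + 1) / x powr \<sigma>)
    \<le> ennreal (p + 1) * (\<integral>\<^sup>+y. ennreal ((f y - f (y / 2)) * f' y * f y powr (p - 1) / y powr \<sigma>) * indicator {x / 2..x} y \<partial>lborel)"
    (is "_ \<le> _ * ?I")
proof -
  define c where "c = f (x / 2)"
  have fm[measurable]: "f \<in> borel_measurable borel"
    using der by (intro borel_measurable_continuous_onI continuous_at_imp_continuous_on)
      (auto intro: DERIV_isCont)
  have c: "c \<ge> 0"
    using mono_onD[OF mono, of 0 "x / 2"] \<open>x > 0\<close> f0 by (simp add: c_def)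
  \<comment> \<open>On the interval the maximum equals \<open>f y - c\<close>. It is written out
    because the antiderivative must have a two-sided derivative also where \<open>f y = c\<close>,
    for instance at the left endpoint.\<close>
  have "(\<integral>\<^sup>+y. ennreal (max 0 (f y - c) powr p * f' y) * indicator {x / 2..x} y \<partial>lborel)
     = ennreal (max 0 (f x - c) powr (p + 1) / (p + 1) - max 0 (f (x / 2) - c) powr (p + 1) / (p + 1))"
  proof (rule nn_integral_FTC_Icc)
    fix y assume "y \<in> {x / 2..x}"
    have "((\<lambda>y. max 0 (f y - c) powr (p + 1)) has_real_derivative (p + 1) * max 0 (f y - c) powr (p + 1 - 1) * f' y) (at y)"
      using \<open>p \<ge> 1\<close> by (intro DERIV_chain2[OF DERIV_max_powr]) (auto intro!: derivative_eq_intros der)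
    from DERIV_cdivide[OF this, of "p + 1"]
    show "((\<lambda>y. max 0 (f y - c) powr (p + 1) / (p + 1)) has_real_derivative max 0 (f y - c) powr p * f' y) (at y)"
      using \<open>p \<ge> 1\<close> by simp
    show "0 \<le> max 0 (f y - c) powr p * f' y"
      using nonneg[of y] \<open>y \<in> {x / 2..x}\<close> \<open>x > 0\<close> by simp
  qed (use \<open>x > 0\<close> in auto)
  also have "\<dots> = ennreal ((f x - c) powr (p + 1) / (p + 1))"
    using mono_onD[OF mono, of "x / 2" x] \<open>x > 0\<close> by (simp add: c_def max_def)
  finally have eq: "(\<integral>\<^sup>+y. ennreal (max 0 (f y - c) powr p * f' y) * indicator {x / 2..x} y \<partial>lborel)
    = ennreal ((f x - c) powr (p + 1) / (p + 1))" .
  have "ennreal (1 / x powr \<sigma>) * ennreal ((f x - c) powr (p + 1) / (p + 1))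
     = (\<integral>\<^sup>+y. ennreal (1 / x powr \<sigma>) * (ennreal (max 0 (f y - c) powr p * f' y) * indicator {x / 2..x} y) \<partial>lborel)"
    by (subst nn_integral_cmult) (auto simp: eq)
  also have "\<dots> \<le> ?I"
  proof (rule nn_integral_mono)
    fix y :: real
    show "ennreal (1 / x powr \<sigma>) * (ennreal (max 0 (f y - c) powr p * f' y) * indicator {x / 2..x} y)
      \<le> ennreal ((f y - f (y / 2)) * f' y * f y powr (p - 1) / y powr \<sigma>) * indicator {x / 2..x} y"
    proof (cases "y \<in> {x / 2..x}")
      case True
      then have y: "y > 0" using \<open>x > 0\<close> by auto
      have d: "f y - c \<le> f y - f (y / 2)"
        using mono_onD[OF mono, of "y / 2" "x / 2"] True y by (simp add: c_def)
      have yc: "f y \<ge> c"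
        using mono_onD[OF mono, of "x / 2" y] True \<open>x > 0\<close> by (simp add: c_def)
      \<comment> \<open>One of the \<open>p\<close> factors is enlarged to the increment at
        \<open>y\<close>, the remaining power \<open>p - 1\<close> to that of \<open>f y\<close>;
        the latter uses \<open>c \<ge> 0\<close> and a nonnegative exponent.\<close>
      have "max 0 (f y - c) powr p = (f y - c) * (f y - c) powr (p - 1)"
        using yc powr_mult_base[of "f y - c" "p - 1"] by simp
      also have "\<dots> \<le> (f y - f (y / 2)) * f y powr (p - 1)"
        using d yc c \<open>p \<ge> 1\<close> by (intro mult_mono powr_mono2) auto
      finally have le: "max 0 (f y - c) powr p \<le> (f y - f (y / 2)) * f y powr (p - 1)" .
      have "1 / x powr \<sigma> \<le> 1 / y powr \<sigma>"
        using True y \<open>\<sigma> > 0\<close> by (intro divide_left_mono powr_mono2) auto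
      then have "1 / x powr \<sigma> * (max 0 (f y - c) powr p * f' y)
         \<le> 1 / y powr \<sigma> * ((f y - f (y / 2)) * f y powr (p - 1) * f' y)"
        using le nonneg[OF y] d yc by (intro mult_mono mult_right_mono) auto
      then show ?thesis
        using True by (simp add: ennreal_leI mult_ac flip: ennreal_mult')
    qed simp
  qed
  finally have "ennreal (1 / x powr \<sigma>) * ennreal ((f x - c) powr (p + 1) / (p + 1)) \<le> ?I" .
  then have "ennreal (p + 1) * (ennreal (1 / x powr \<sigma>) * ennreal ((f x - c) powr (p + 1) / (p + 1)))
      \<le> ennreal (p + 1) * ?I"
    by (rule mult_left_mono) simp
  moreover have "ennreal ((f x - c) powr (p + 1) / x powr \<sigma>)
     = ennreal (p + 1) * (ennreal (1 / x powr \<sigma>) * ennreal ((f x - c) powr (p + 1) / (p + 1)))"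
    using \<open>p \<ge> 1\<close> by (simp del: ennreal_plus flip: ennreal_mult')
  ultimately show ?thesis
    by (simp only: c_def)
qed

text \<open>The estimate on \<open>[x / 2, x]\<close> is integrated against \<open>1 / x\<close>,
  which raises the exponent of the weight from \<open>\<sigma>\<close> to
  \<open>1 + \<sigma>\<close>, and the order of integration is exchanged. Everything is nonnegative,
  so Tonelli applies even to infinite integrals.\<close>

lemma nn_integral_powr_increment_le:
  fixes f :: "real \<Rightarrow> real" and p \<sigma> :: real
  assumes "p \<ge> 1" "\<sigma> > 0"
    and der: "\<And>y. (f has_real_derivative f' y) (at y)"
    and nonneg: "\<And>y. y > 0 \<Longrightarrow> f' y \<ge> 0"
    and mono: "mono_on {0..} f" and f0: "f 0 = 0"
    and [measurable]: "f' \<in> borel_measurable borel"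
  shows "(\<integral>\<^sup>+x\<in>{0<..<1}. ennreal ((f x - f (x / 2)) powr (p + 1) / x powr (1 + \<sigma>)) \<partial>lborel)
    \<le> ennreal (p + 1) * (\<integral>\<^sup>+x\<in>{0<..<1}. ennreal ((f x - f (x / 2)) * f' x * f x powr (p - 1) / x powr \<sigma>) \<partial>lborel)"
proof -
  define G where "G y = ennreal ((f y - f (y / 2)) * f' y * f y powr (p - 1) / y powr \<sigma>)" for y
  have [measurable]: "f \<in> borel_measurable borel"
    using der by (intro borel_measurable_continuous_onI continuous_at_imp_continuous_on)
      (auto intro: DERIV_isCont)
  have [measurable]: "G \<in> borel_measurable borel"
    unfolding G_def by measurable
  define D where "D = {(x::real, y). 0 < x \<and> x < 1 \<and> x / 2 \<le> y \<and> y \<le> x}"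
  have D[measurable]: "D \<in> sets (borel \<Otimes>\<^sub>M borel)"
  proof -
    have "D = {z \<in> space (borel \<Otimes>\<^sub>M borel). 0 < fst z \<and> fst z < 1 \<and> fst z / 2 \<le> snd z \<and> snd z \<le> fst z}"
      by (auto simp: D_def space_pair_measure)
    also have "\<dots> \<in> sets (borel \<Otimes>\<^sub>M borel)" by measurable
    finally show ?thesis .
  qed
  define k where "k x y = ennreal (1 / x) * G y * indicator D (x, y)" for x y
  have k_meas: "case_prod k \<in> borel_measurable (lborel \<Otimes>\<^sub>M lborel)"
    unfolding k_def by measurable
  have "(\<integral>\<^sup>+x\<in>{0<..<1}. ennreal ((f x - f (x / 2)) powr (p + 1) / x powr (1 + \<sigma>)) \<partial>lborel)
    \<le> (\<integral>\<^sup>+x. ennreal (p + 1) * (\<integral>\<^sup>+y. k x y \<partial>lborel) \<partial>lborel)"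
  proof (rule nn_integral_mono)
    fix x :: real
    show "ennreal ((f x - f (x / 2)) powr (p + 1) / x powr (1 + \<sigma>)) * indicator {0<..<1} x
      \<le> ennreal (p + 1) * (\<integral>\<^sup>+y. k x y \<partial>lborel)"
    proof (cases "x \<in> {0<..<1}")
      case True
      then have "ennreal ((f x - f (x / 2)) powr (p + 1) / x powr (1 + \<sigma>))
        = ennreal (1 / x) * ennreal ((f x - f (x / 2)) powr (p + 1) / x powr \<sigma>)"
        by (simp add: powr_add flip: ennreal_mult')
      also have "\<dots> \<le> ennreal (1 / x) * (ennreal (p + 1) * (\<integral>\<^sup>+y. G y * indicator {x / 2..x} y \<partial>lborel))"
        unfolding G_def using True assms
        by (intro mult_left_mono powr_increment_le_nn_integral) auto
      also have "\<dots> = ennreal (p + 1) * (\<integral>\<^sup>+y. ennreal (1 / x) * (G y * indicator {x / 2..x} y) \<partial>lborel)"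
        by (subst nn_integral_cmult) (auto simp: mult_ac)
      also have "(\<integral>\<^sup>+y. ennreal (1 / x) * (G y * indicator {x / 2..x} y) \<partial>lborel) = (\<integral>\<^sup>+y. k x y \<partial>lborel)"
        using True by (intro nn_integral_cong) (auto simp: k_def D_def split: split_indicator)
      finally show ?thesis using True by simp
    qed simp
  qed
  also have "\<dots> = ennreal (p + 1) * (\<integral>\<^sup>+x. \<integral>\<^sup>+y. k x y \<partial>lborel \<partial>lborel)"
    using k_meas by (intro nn_integral_cmult lborel.borel_measurable_nn_integral) simp
  finally have le: "(\<integral>\<^sup>+x\<in>{0<..<1}. ennreal ((f x - f (x / 2)) powr (p + 1) / x powr (1 + \<sigma>)) \<partial>lborel)
    \<le> ennreal (p + 1) * (\<integral>\<^sup>+x. \<integral>\<^sup>+y. k x y \<partial>lborel \<partial>lborel)" .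
  have "(\<integral>\<^sup>+x. \<integral>\<^sup>+y. k x y \<partial>lborel \<partial>lborel) = (\<integral>\<^sup>+y. \<integral>\<^sup>+x. k x y \<partial>lborel \<partial>lborel)"
    by (rule lborel_pair.Fubini'[OF k_meas, symmetric])
  also have "\<dots> \<le> (\<integral>\<^sup>+y. G y * indicator {0<..<1} y \<partial>lborel)"
  proof (rule nn_integral_mono)
    fix y :: real
    show "(\<integral>\<^sup>+x. k x y \<partial>lborel) \<le> G y * indicator {0<..<1} y"
    proof (cases "y \<in> {0<..<1}")
      case True
      \<comment> \<open>For fixed \<open>y\<close> the admissible \<open>x\<close> lie in
        \<open>[y, 2 * y]\<close>, where \<open>1 / x \<le> 1 / y\<close>. This interval has length
        \<open>y\<close>, so \<open>1 / x\<close> has mass at most \<open>1\<close> on it and the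
        constant stays \<open>p + 1\<close>.\<close>
      have "(\<integral>\<^sup>+x. k x y \<partial>lborel) \<le> (\<integral>\<^sup>+x. ennreal (1 / y) * G y * indicator {y..2 * y} x \<partial>lborel)"
        using True by (intro nn_integral_mono)
          (auto simp: k_def D_def frac_le split: split_indicator intro!: mult_right_mono ennreal_leI)
      also have "\<dots> = ennreal (1 / y) * G y * emeasure lborel {y..2 * y}"
        by (intro nn_integral_cmult_indicator) simp
      also have "\<dots> = G y * (ennreal (1 / y) * ennreal y)"
        using True by (simp add: mult_ac)
      also have "\<dots> = G y"
        using True by (simp flip: ennreal_mult')
      finally show ?thesis using True by simp
    next
      case False
      then have "k x y = 0" for x by (auto simp: k_def D_def)
      then show ?thesis by simp
    qed
  qed
  finally have "(\<integral>\<^sup>+x. \<integral>\<^sup>+y. k x y \<partial>lborel \<partial>lborel) \<le> (\<integral>\<^sup>+y\<in>{0<..<1}. G y \<partial>lborel)" .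
  from order.trans[OF le mult_left_mono[OF this]] show ?thesis
    by (simp only: G_def zero_le)
qed


section \<open>The Hilbert transform of an even function increasing on the half-line\<close>

lemma set_integrable_inverse_square_atLeast:
  fixes a :: real
  assumes "a > 0"
  shows "set_integrable lborel {a..} (\<lambda>y. 1 / y\<^sup>2)"
    and "(LBINT y:{a..}. 1 / y\<^sup>2) = 1 / a"
proof -
  have "(\<integral>\<^sup>+y. ennreal (1 / y\<^sup>2) * indicator {a..} y \<partial>lborel) = ennreal (0 - (- (1 / a)))"
  proof (rule nn_integral_FTC_atLeast)
    show "((\<lambda>y. - (1 / y)) has_real_derivative 1 / y\<^sup>2) (at y)" if "a \<le> y" for y
      using that assms by (auto intro!: derivative_eq_intros simp: power2_eq_square)
    have "((\<lambda>y::real. - (1 / y)) \<longlongrightarrow> - 0) at_top"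
      by (intro tendsto_intros tendsto_divide_0[OF tendsto_const] filterlim_at_top_imp_at_infinity filterlim_ident)
    then show "((\<lambda>y::real. - (1 / y)) \<longlongrightarrow> 0) at_top" by simp
  qed auto
  also have "(\<integral>\<^sup>+y. ennreal (1 / y\<^sup>2) * indicator {a..} y \<partial>lborel)
      = (\<integral>\<^sup>+y. ennreal (indicator {a..} y *\<^sub>R (1 / y\<^sup>2)) \<partial>lborel)"
    by (intro nn_integral_cong) (auto split: split_indicator)
  finally have "has_bochner_integral lborel (\<lambda>y. indicator {a..} y *\<^sub>R (1 / y\<^sup>2)) (1 / a)"
    using assms by (intro has_bochner_integral_nn_integral) auto
  then show "set_integrable lborel {a..} (\<lambda>y. 1 / y\<^sup>2)" "(LBINT y:{a..}. 1 / y\<^sup>2) = 1 / a"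
    by (auto simp: set_integrable_def set_lebesgue_integral_def has_bochner_integral_iff)
qed

text \<open>The integral is at most length times bound, \<open>2 * \<epsilon> * B\<close>. It shows
  that the window cut out around the singularity contributes nothing in the limit once the integrand
  is bounded.\<close>

lemma set_integral_symmetric_interval_tendsto_0:
  fixes g :: "real \<Rightarrow> real"
  assumes int: "set_integrable lborel {x - \<delta>..x + \<delta>} g" and "\<delta> > 0"
    and B: "\<And>y. y \<in> {x - \<delta>..x + \<delta>} \<Longrightarrow> \<bar>g y\<bar> \<le> B"
  shows "((\<lambda>\<epsilon>. LBINT y:{x - \<epsilon>..x + \<epsilon>}. g y) \<longlongrightarrow> 0) (at_right 0)"
proof (rule Lim_null_comparison)
  show "\<forall>\<^sub>F \<epsilon> in at_right 0. norm (LBINT y:{x - \<epsilon>..x + \<epsilon>}. g y) \<le> 2 * \<epsilon> * B"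
  proof (rule eventually_at_rightI[OF _ \<open>\<delta> > 0\<close>])
    fix \<epsilon> assume e: "\<epsilon> \<in> {0<..<\<delta>}"
    have int': "set_integrable lborel {x - \<epsilon>..x + \<epsilon>} g"
      using e by (intro set_integrable_subset[OF int]) auto
    have "norm (LBINT y:{x - \<epsilon>..x + \<epsilon>}. g y) \<le> (LBINT y:{x - \<epsilon>..x + \<epsilon>}. norm (g y))"
      by (rule set_integral_norm_bound[OF int'])
    also have "\<dots> \<le> (LBINT y:{x - \<epsilon>..x + \<epsilon>}. B)"
      using e B by (intro set_integral_mono set_integrable_norm int' borel_integrable_atLeastAtMost') auto
    also have "\<dots> = 2 * \<epsilon> * B"
      using e by (subst set_integral_const) auto
    finally show "norm (LBINT y:{x - \<epsilon>..x + \<epsilon>}. g y) \<le> 2 * \<epsilon> * B" .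
  qed
  have "((\<lambda>\<epsilon>. 2 * \<epsilon> * B) \<longlongrightarrow> 2 * 0 * B) (at_right 0)"
    by (intro tendsto_intros)
  then show "((\<lambda>\<epsilon>. 2 * \<epsilon> * B) \<longlongrightarrow> 0) (at_right 0)" by simp
qed

text \<open>The point \<open>x\<close> is fixed throughout. Smoothness of \<open>f\<close> enters
  only through the Lipschitz bound based at \<open>x\<close>, which controls the difference quotient
  near the singularity; the bound \<open>M\<close> controls the behaviour at infinity.\<close>

locale even_mono_kernel =
  fixes f :: "real \<Rightarrow> real" and x M L :: real
  assumes x: "x > 0"
    and cont: "continuous_on UNIV f"
    and even: "\<And>y. f (- y) = f y"
    and mono: "mono_on {0..} f"
    and bdd: "\<And>y. \<bar>f y\<bar> \<le> M"
    and lip: "\<And>y. y \<in> {0..2 * x} \<Longrightarrow> \<bar>f y - f x\<bar> \<le> L * \<bar>y - x\<bar>"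
begin

text \<open>At \<open>y = x\<close> division by zero gives \<open>k x = 0\<close>.\<close>

definition k :: "real \<Rightarrow> real" where
  "k y = 2 * x * (f y - f x) / (y\<^sup>2 - x\<^sup>2)"

section \<open>Sign, bounds and integrability of \<open>k\<close>, and the truncated principal
  value\<close>

lemma f_measurable [measurable]: "f \<in> borel_measurable borel"
  by (rule borel_measurable_continuous_onI[OF cont])

lemma k_measurable [measurable]: "k \<in> borel_measurable borel"
  unfolding k_def by measurable

text \<open>Separates the difference quotient of \<open>f\<close> at \<open>x\<close> from a factor
  that is bounded for \<open>y \<ge> 0\<close>. The identity is unconditional, since at
  \<open>y = x\<close> and \<open>y = - x\<close> division by zero makes both sides
  \<open>0\<close>.\<close>

lemma k_factor: "k y = 2 * x / (y + x) * ((f y - f x) / (y - x))"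
  by (simp add: k_def power2_eq_square algebra_simps)

lemma k_nonneg: "y \<ge> 0 \<Longrightarrow> k y \<ge> 0"
proof -
  assume y: "y \<ge> 0"
  have "(f y - f x) / (y - x) \<ge> 0"
    using mono_onD[OF mono, of x y] mono_onD[OF mono, of y x] y x
    by (cases "y \<le> x") (auto intro: divide_nonpos_nonpos divide_nonneg_nonneg)
  then show ?thesis
    unfolding k_factor using x y by (intro mult_nonneg_nonneg) auto
qed

lemma L_nonneg: "L \<ge> 0"
proof -
  have "0 \<le> \<bar>f 0 - f x\<bar>" by simp
  also have "\<dots> \<le> L * x" using lip[of 0] x by simp
  finally show ?thesis using x by (simp add: zero_le_mult_iff)
qed

lemma k_le_near: "y \<in> {0..2 * x} \<Longrightarrow> \<bar>k y\<bar> \<le> 2 * L"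
proof -
  assume y: "y \<in> {0..2 * x}"
  have "\<bar>f y - f x\<bar> / \<bar>y - x\<bar> \<le> L"
    using lip[OF y] L_nonneg by (cases "y = x") (auto simp: field_simps)
  moreover have "\<bar>2 * x / (y + x)\<bar> \<le> 2"
    using y x by (auto simp: field_simps)
  ultimately show ?thesis
    unfolding k_factor abs_mult abs_divide[of "f y - f x"] by (intro mult_mono) auto
qed

text \<open>Here \<open>x\<^sup>2\<close> is at most a quarter of \<open>y\<^sup>2\<close>, so the
  denominator is at least \<open>y\<^sup>2 / 2\<close>, while the numerator is at most
  \<open>4 * x * M\<close>; hence the constant \<open>8\<close>.\<close>

lemma k_le_far: "y \<ge> 2 * x \<Longrightarrow> \<bar>k y\<bar> \<le> 8 * x * M * (1 / y\<^sup>2)"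
proof -
  assume y: "y \<ge> 2 * x"
  have "y * y \<ge> (2 * x) * (2 * x)"
    using y x by (intro mult_mono) auto
  then have "y\<^sup>2 / 2 \<le> \<bar>y\<^sup>2 - x\<^sup>2\<bar>"
    using zero_le_square[of x] unfolding power2_eq_square by linarith
  moreover have "y\<^sup>2 > 0" using x y by simp
  moreover have "\<bar>2 * x * (f y - f x)\<bar> \<le> 2 * x * (2 * M)"
    unfolding abs_mult using x bdd[of y] bdd[of x] by (intro mult_mono) auto
  ultimately have "\<bar>2 * x * (f y - f x)\<bar> / \<bar>y\<^sup>2 - x\<^sup>2\<bar> \<le> 2 * x * (2 * M) / (y\<^sup>2 / 2)"
    by (intro frac_le) auto
  then show ?thesis by (simp add: k_def abs_divide field_simps)
qed

text \<open>The half-line is cut at \<open>2 * x\<close>, where the Lipschitz bound gives way to the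
  inverse square decay.\<close>

lemma k_integrable: "set_integrable lborel {0..} k"
proof -
  have 1: "set_integrable lborel {0..2 * x} k"
    by (rule set_integrable_bound[where f="\<lambda>_. 2 * L"])
       (auto intro!: borel_integrable_atLeastAtMost' AE_I2 simp: set_borel_measurable_def
         intro: order.trans[OF k_le_near] abs_ge_self)
  have 2: "set_integrable lborel {2 * x..} k"
    using x set_integrable_inverse_square_atLeast[of "2 * x"] order.trans[OF k_le_far abs_ge_self]
    by (intro set_integrable_bound[where f="\<lambda>y. 8 * x * M * (1 / y\<^sup>2)" and g=k and A="{2 * x..}"]
          set_integrable_mult_right)
       (auto simp: set_borel_measurable_def)
  have "{0..} = {0..2 * x} \<union> {2 * x..}" using x by auto
  then show ?thesis using set_integrable_Un[OF 1 2] by simp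
qed

lemma k_integrable_subset: "A \<in> sets borel \<Longrightarrow> A \<subseteq> {0..} \<Longrightarrow> set_integrable lborel A k"
  by (rule set_integrable_subset[OF k_integrable]) auto

lemma k_tail_tendsto_0: "((\<lambda>R. LBINT y:{R..}. k y) \<longlongrightarrow> 0) at_top"
proof (rule Lim_null_comparison)
  show "\<forall>\<^sub>F R in at_top. norm (LBINT y:{R..}. k y) \<le> 8 * x * M * (1 / R)"
    using eventually_ge_at_top[of "2 * x"]
  proof eventually_elim
    case (elim R)
    then have R: "R > 0" using x by simp
    have int: "set_integrable lborel {R..} k"
      using R by (intro k_integrable_subset) auto
    have "norm (LBINT y:{R..}. k y) \<le> (LBINT y:{R..}. norm (k y))"
      by (rule set_integral_norm_bound[OF int])
    also have "\<dots> \<le> (LBINT y:{R..}. 8 * x * M * (1 / y\<^sup>2))"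
      using elim R k_le_far set_integrable_inverse_square_atLeast[of R]
      by (intro set_integral_mono set_integrable_norm int set_integrable_mult_right) auto
    also have "\<dots> = 8 * x * M * (1 / R)"
      using set_integrable_inverse_square_atLeast[of R] R
      by (subst set_integral_mult_right) auto
    finally show ?case .
  qed
  have "((\<lambda>R. 8 * x * M * (1 / R)) \<longlongrightarrow> 8 * x * M * 0) at_top"
    by (intro tendsto_intros tendsto_divide_0[OF tendsto_const] filterlim_at_top_imp_at_infinity filterlim_ident)
  then show "((\<lambda>R. 8 * x * M * (1 / R)) \<longlongrightarrow> 0) at_top" by simp
qed

text \<open>For \<open>0 \<le> y \<le> x / 2\<close> monotonicity gives
  \<open>f x - f y \<ge> f x - f (x / 2)\<close>, and
  \<open>x\<^sup>2 - y\<^sup>2 \<le> x\<^sup>2\<close>; so \<open>k y\<close> is at least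
  \<open>2 / x\<close> times the increment, on an interval of length \<open>x / 2\<close>. The rest
  of the half-line contributes a nonnegative amount.\<close>

lemma increment_le_integral_k: "f x - f (x / 2) \<le> (LBINT y:{0..}. k y)"
proof -
  have "f x - f (x / 2) = (LBINT y:{0..x / 2}. 2 / x * (f x - f (x / 2)))"
    using x by (subst set_integral_const) auto
  also have "\<dots> \<le> (LBINT y:{0..x / 2}. k y)"
  proof (intro set_integral_mono k_integrable_subset borel_integrable_atLeastAtMost')
    fix y assume y: "y \<in> {0..x / 2}"
    have "2 / x * (f x - f (x / 2)) = 2 * x * (f x - f (x / 2)) / x\<^sup>2"
      using x by (simp add: power2_eq_square)
    also have "\<dots> \<le> 2 * x * (f x - f y) / (x\<^sup>2 - y\<^sup>2)"
      using x y mono_onD[OF mono, of y "x / 2"] mono_onD[OF mono, of "x / 2" x]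
        power_strict_mono[of y x 2]
      by (intro frac_le mult_left_mono mult_nonneg_nonneg) auto
    also have "\<dots> = k y"
      unfolding k_def using minus_divide_divide[of "2 * x * (f x - f y)" "x\<^sup>2 - y\<^sup>2"]
      by (simp add: algebra_simps)
    finally show "2 / x * (f x - f (x / 2)) \<le> k y" .
  qed auto
  also have "\<dots> \<le> (LBINT y:{0..}. k y)"
    unfolding set_lebesgue_integral_def
    using k_integrable k_integrable_subset[of "{0..x / 2}"] k_nonneg
    by (intro integral_mono) (auto simp: set_integrable_def split: split_indicator)
  finally show ?thesis .
qed

text \<open>Evenness folds the negative half-line onto the positive one, where
  \<open>1 / (x - y) + 1 / (x + y) = 2 * x / (x\<^sup>2 - y\<^sup>2)\<close>. Writing
  \<open>f y = f x + (f y - f x)\<close> splits off a logarithm and leaves \<open>- k\<close>. The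
  window around \<open>x\<close> is cut out only on the positive side, so the reflected half still
  covers it; this is the last summand.\<close>

lemma truncated_integral:
  assumes e: "0 < \<epsilon>" "\<epsilon> < x" and R: "x + \<epsilon> < R"
  shows "(LBINT y:{y. \<epsilon> < \<bar>x - y\<bar> \<and> \<bar>y\<bar> < R}. f y / (x - y)) =
    f x * ((ln (2 * x - \<epsilon>) - ln (2 * x + \<epsilon>)) + (ln (R + x) - ln (R - x)))
    - ((LBINT y:{0..}. k y) - (LBINT y:{x - \<epsilon>..x + \<epsilon>}. k y) - (LBINT y:{R..}. k y))
    + (LBINT y:{x - \<epsilon>..x + \<epsilon>}. f y / (x + y))"
proof -
  \<comment> \<open>\<open>P1\<close> and \<open>P2\<close> are the retained positive points on
    either side of \<open>x\<close>, \<open>N\<close> is the negative half and \<open>E\<close> the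
    window that was cut out.\<close>
  define P1 where "P1 = {0..<x - \<epsilon>}"
  define P2 where "P2 = {x + \<epsilon><..<R}"
  define N where "N = {-R<..<0}"
  define E where "E = {x - \<epsilon>..x + \<epsilon>}"
  have sub: "P1 \<subseteq> {0..x - \<epsilon>}" "P2 \<subseteq> {x + \<epsilon>..R}" "N \<subseteq> {-R..0}"
    by (auto simp: P1_def P2_def N_def)
  have [measurable]: "P1 \<in> sets borel" "P2 \<in> sets borel" "N \<in> sets borel" "E \<in> sets borel"
    by (auto simp: P1_def P2_def N_def E_def)
  have fcont: "continuous_on A f" for A
    using cont continuous_on_subset by blast
  have i1: "set_integrable lborel P1 (\<lambda>y. f y / (x - y))"
    using e by (intro set_integrable_subset[OF _ _ sub(1)] borel_integrable_atLeastAtMost'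
      continuous_intros fcont) auto
  have i2: "set_integrable lborel P2 (\<lambda>y. f y / (x - y))"
    using e by (intro set_integrable_subset[OF _ _ sub(2)] borel_integrable_atLeastAtMost'
      continuous_intros fcont) auto
  have i3: "set_integrable lborel N (\<lambda>y. f y / (x - y))"
    using x by (intro set_integrable_subset[OF _ _ sub(3)] borel_integrable_atLeastAtMost'
      continuous_intros fcont) auto
  have j: "set_integrable lborel {0..R} (\<lambda>y. f y / (x + y))"
    using x by (intro borel_integrable_atLeastAtMost' continuous_intros fcont) auto
  have j': "set_integrable lborel A (\<lambda>y. f y / (x + y))" if "A \<in> sets borel" "A \<subseteq> {0..R}" for A
    using that by (intro set_integrable_subset[OF j]) auto
  have S: "{y. \<epsilon> < \<bar>x - y\<bar> \<and> \<bar>y\<bar> < R} = N \<union> (P1 \<union> P2)"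
    using e R x by (auto simp: N_def P1_def P2_def)
  have split3: "(LBINT y:A \<union> (B \<union> C). g y) = (LBINT y:A. g y) + ((LBINT y:B. g y) + (LBINT y:C. g y))"
    if "set_integrable lborel A g" "set_integrable lborel B g" "set_integrable lborel C g"
      "A \<inter> (B \<union> C) = {}" "B \<inter> C = {}" "B \<in> sets borel" "C \<in> sets borel"
    for A B C and g :: "real \<Rightarrow> real"
    using that by (simp add: set_integral_Un set_integrable_Un)
  have eq1: "(LBINT y:N \<union> (P1 \<union> P2). f y / (x - y))
      = (LBINT y:N. f y / (x - y)) + ((LBINT y:P1. f y / (x - y)) + (LBINT y:P2. f y / (x - y)))"
    using e R i1 i2 i3 x by (intro split3) (auto simp: N_def P1_def P2_def)
  \<comment> \<open>Reflection turns \<open>x - y\<close> into \<open>x + y\<close>. The null set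
    \<open>{0}\<close> is then added so that the domain splits exactly into \<open>E\<close>,
    \<open>P1\<close> and \<open>P2\<close>.\<close>
  have "(LBINT y:N. f y / (x - y)) = (LBINT y:{0<..<R}. f y / (x + y))"
    by (subst set_integral_reflect) (auto simp: N_def even intro!: arg_cong2[where f="set_lebesgue_integral lborel"])
  also have "\<dots> = (LBINT y:{0..<R}. f y / (x + y))"
    by (rule set_integral_discrete_difference[where X="{0}"]) auto
  also have "{0..<R} = E \<union> (P1 \<union> P2)"
    using e R x by (auto simp: E_def P1_def P2_def)
  also have "(LBINT y:E \<union> (P1 \<union> P2). f y / (x + y))
      = (LBINT y:E. f y / (x + y)) + ((LBINT y:P1. f y / (x + y)) + (LBINT y:P2. f y / (x + y)))"
    using e R by (intro split3 j') (auto simp: E_def P1_def P2_def)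
  finally have eq2: "(LBINT y:N. f y / (x - y))
      = (LBINT y:E. f y / (x + y)) + ((LBINT y:P1. f y / (x + y)) + (LBINT y:P2. f y / (x + y)))" .
  have eq3: "(LBINT y:{0..}. k y)
      = (LBINT y:E. k y) + (LBINT y:{R..}. k y) + ((LBINT y:P1. k y) + (LBINT y:P2. k y))"
  proof -
    have "{0..} = (E \<union> {R..}) \<union> (P1 \<union> P2)"
      using e R x by (auto simp: E_def P1_def P2_def)
    then have "(LBINT y:{0..}. k y) = (LBINT y:E \<union> {R..}. k y) + ((LBINT y:P1. k y) + (LBINT y:P2. k y))"
      using e R x by (simp only:) (intro split3 k_integrable_subset, auto simp: E_def P1_def P2_def)
    also have "(LBINT y:E \<union> {R..}. k y) = (LBINT y:E. k y) + (LBINT y:{R..}. k y)"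
      using e R x by (intro set_integral_Un k_integrable_subset) (auto simp: E_def)
    finally show ?thesis .
  qed
  have comb: "(LBINT y:A. f y / (x - y)) + (LBINT y:A. f y / (x + y))
      = f x * (LBINT y:A. 2 * x / (x\<^sup>2 - y\<^sup>2)) - (LBINT y:A. k y)"
    if A: "A \<in> sets borel" "A \<subseteq> {0..R}" "x \<notin> A" 
      and i: "set_integrable lborel A (\<lambda>y. f y / (x - y))"
      and i': "set_integrable lborel A (\<lambda>y. 2 * x / (x\<^sup>2 - y\<^sup>2))" for A
  proof -
    have ik: "set_integrable lborel A k"
      using A by (intro k_integrable_subset) auto
    have "(LBINT y:A. f y / (x - y)) + (LBINT y:A. f y / (x + y)) = (LBINT y:A. f y / (x - y) + f y / (x + y))"
      using i j'[OF A(1,2)] by (simp add: set_integral_add)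
    also have "\<dots> = (LBINT y:A. f x * (2 * x / (x\<^sup>2 - y\<^sup>2)) - k y)"
    proof (rule set_lebesgue_integral_cong)
      show "\<forall>y. y \<in> A \<longrightarrow> f y / (x - y) + f y / (x + y) = f x * (2 * x / (x\<^sup>2 - y\<^sup>2)) - k y"
      proof (intro allI impI)
        fix y assume "y \<in> A"
        then have *: "x - y \<noteq> 0" "x + y \<noteq> 0" using A x by auto
        define D where "D = (x - y) * (x + y)"
        have D: "x\<^sup>2 - y\<^sup>2 = D" "y\<^sup>2 - x\<^sup>2 = - D"
          by (auto simp: D_def power2_eq_square algebra_simps)
        have "f y / (x - y) + f y / (x + y) = 2 * x * f y / D"
          using * by (simp add: D_def field_simps)
        also have "\<dots> = f x * (2 * x / (x\<^sup>2 - y\<^sup>2)) - k y"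
          unfolding k_def D by (simp add: right_diff_distrib diff_divide_distrib)
        finally show "f y / (x - y) + f y / (x + y) = f x * (2 * x / (x\<^sup>2 - y\<^sup>2)) - k y" .
      qed
    qed (use A in auto)
    also have "\<dots> = f x * (LBINT y:A. 2 * x / (x\<^sup>2 - y\<^sup>2)) - (LBINT y:A. k y)"
      using set_integral_diff(2)[OF set_integrable_mult_right[OF i', of "f x"] ik]
        set_integral_mult_right[of lborel A "f x" "\<lambda>y. 2 * x / (x\<^sup>2 - y\<^sup>2)"]
      by simp
    finally show ?thesis .
  qed
  have sq: "x\<^sup>2 - y\<^sup>2 \<noteq> 0" if "y \<ge> 0" "y \<noteq> x" for y
    using that x by (auto simp: power2_eq_iff)
  have c1: "continuous_on {0..x - \<epsilon>} (\<lambda>y. 2 * x / (x\<^sup>2 - y\<^sup>2))"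
    using e sq by (intro continuous_intros) auto
  have c2: "continuous_on {x + \<epsilon>..R} (\<lambda>y. 2 * x / (x\<^sup>2 - y\<^sup>2))"
    using e x sq by (intro continuous_intros) auto
  \<comment> \<open>Partial fractions: the antiderivative is \<open>ln (x + y) - ln (x - y)\<close>
    below \<open>x\<close> and \<open>ln (y + x) - ln (y - x)\<close> above it.\<close>
  have der: "2 * x / (x\<^sup>2 - y\<^sup>2) = 1 / (x + y) + 1 / (x - y)" if "y \<ge> 0" "y \<noteq> x" for y
  proof -
    have "x\<^sup>2 - y\<^sup>2 = (x - y) * (x + y)" by (auto simp: power2_eq_square algebra_simps)
    then show ?thesis using that x by (simp add: divide_simps)
  qed
  have "(LBINT y:P1. 2 * x / (x\<^sup>2 - y\<^sup>2)) = (LBINT y=ereal 0..ereal (x - \<epsilon>). 2 * x / (x\<^sup>2 - y\<^sup>2))"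
    unfolding P1_def using e by (subst interval_integral_Ico) auto
  also have "\<dots> = (ln (x + (x - \<epsilon>)) - ln (x - (x - \<epsilon>))) - (ln (x + 0) - ln (x - 0))"
  proof (rule interval_integral_FTC_finite)
    show "continuous_on {min 0 (x - \<epsilon>)..max 0 (x - \<epsilon>)} (\<lambda>y. 2 * x / (x\<^sup>2 - y\<^sup>2))"
      using c1 e by simp
    fix y assume y: "min 0 (x - \<epsilon>) \<le> y" "y \<le> max 0 (x - \<epsilon>)"
    then have "((\<lambda>y. ln (x + y) - ln (x - y)) has_real_derivative 2 * x / (x\<^sup>2 - y\<^sup>2)) (at y)"
      using e der[of y] by (auto intro!: derivative_eq_intros)
    then show "((\<lambda>y. ln (x + y) - ln (x - y)) has_vector_derivative 2 * x / (x\<^sup>2 - y\<^sup>2))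
        (at y within {min 0 (x - \<epsilon>)..max 0 (x - \<epsilon>)})"
      by (auto simp: has_real_derivative_iff_has_vector_derivative intro: has_vector_derivative_at_within)
  qed
  finally have l1: "(LBINT y:P1. 2 * x / (x\<^sup>2 - y\<^sup>2)) = ln (2 * x - \<epsilon>) - ln \<epsilon>"
    by simp
  have "(LBINT y:P2. 2 * x / (x\<^sup>2 - y\<^sup>2)) = (LBINT y=x + \<epsilon>..R. 2 * x / (x\<^sup>2 - y\<^sup>2))"
    unfolding P2_def using R by (subst interval_integral_Ioo) auto
  also have "\<dots> = (ln (R + x) - ln (R - x)) - (ln (x + \<epsilon> + x) - ln (x + \<epsilon> - x))"
  proof (rule interval_integral_FTC_finite)
    show "continuous_on {min (x + \<epsilon>) R..max (x + \<epsilon>) R} (\<lambda>y. 2 * x / (x\<^sup>2 - y\<^sup>2))"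
      using c2 R by simp
    fix y assume y: "min (x + \<epsilon>) R \<le> y" "y \<le> max (x + \<epsilon>) R"
    then have "x < y" "0 < y" using e x R by auto
    then have "((\<lambda>y. ln (y + x) - ln (y - x)) has_real_derivative 2 * x / (x\<^sup>2 - y\<^sup>2)) (at y)"
      using x der[of y] minus_divide_divide[of 1 "x - y"]
      by (auto intro!: derivative_eq_intros simp: add.commute)
    then show "((\<lambda>y. ln (y + x) - ln (y - x)) has_vector_derivative 2 * x / (x\<^sup>2 - y\<^sup>2))
        (at y within {min (x + \<epsilon>) R..max (x + \<epsilon>) R})"
      by (auto simp: has_real_derivative_iff_has_vector_derivative intro: has_vector_derivative_at_within)
  qed
  finally have l2: "(LBINT y:P2. 2 * x / (x\<^sup>2 - y\<^sup>2)) = (ln (R + x) - ln (R - x)) - (ln (2 * x + \<epsilon>) - ln \<epsilon>)"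
    by (simp add: algebra_simps)
  \<comment> \<open>The term \<open>ln \<epsilon>\<close> occurs in \<open>l1\<close> and
    \<open>l2\<close> with opposite signs and disappears when \<open>m1\<close> and
    \<open>m2\<close> are added; this is the cancellation of the principal value.\<close>
  have m1: "(LBINT y:P1. f y / (x - y)) + (LBINT y:P1. f y / (x + y))
      = f x * (ln (2 * x - \<epsilon>) - ln \<epsilon>) - (LBINT y:P1. k y)"
    unfolding l1[symmetric] using i1 e R
    by (intro comb set_integrable_subset[OF borel_integrable_atLeastAtMost'[OF c1] _ sub(1)])
       (auto simp: P1_def)
  have m2: "(LBINT y:P2. f y / (x - y)) + (LBINT y:P2. f y / (x + y))
      = f x * ((ln (R + x) - ln (R - x)) - (ln (2 * x + \<epsilon>) - ln \<epsilon>)) - (LBINT y:P2. k y)"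
    unfolding l2[symmetric] using i2 e R x
    by (intro comb set_integrable_subset[OF borel_integrable_atLeastAtMost'[OF c2] _ sub(2)])
       (auto simp: P2_def)
  show ?thesis
    unfolding S eq1 eq2 E_def[symmetric] eq3 using m1 m2 by (simp add: algebra_simps)
qed

text \<open>In the formula for the truncated integral every term except the full integral of
  \<open>k\<close> tends to \<open>0\<close>. Each of them depends on \<open>\<epsilon>\<close>
  alone or on \<open>R\<close> alone, so the joint limit follows from one-variable limits composed
  with the projections.\<close>

lemma hilbert_transform_eq: "hilbert_transform f x = - (1 / pi) * (LBINT y:{0..}. k y)"
proof -
  define I where "I = (LBINT y:{0..}. k y)"
  define T where "T \<epsilon> R = f x * ((ln (2 * x - \<epsilon>) - ln (2 * x + \<epsilon>)) + (ln (R + x) - ln (R - x)))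
    - (I - (LBINT y:{x - \<epsilon>..x + \<epsilon>}. k y) - (LBINT y:{R..}. k y))
    + (LBINT y:{x - \<epsilon>..x + \<epsilon>}. f y / (x + y))" for \<epsilon> R
  let ?F = "at_right (0::real) \<times>\<^sub>F (at_top :: real filter)"
  have fst: "filterlim fst (at_right 0) ?F" and snd: "filterlim snd at_top ?F"
    by (rule filterlim_fst filterlim_snd)+
  have l1: "((\<lambda>\<epsilon>. ln (2 * x - \<epsilon>) - ln (2 * x + \<epsilon>)) \<longlongrightarrow> ln (2 * x - 0) - ln (2 * x + 0)) (at_right 0)"
    using x by (intro tendsto_intros) auto
  have "((\<lambda>R. ln (1 + 2 * x / (R + - x))) \<longlongrightarrow> ln (1 + 0)) at_top"
    by (intro tendsto_intros tendsto_divide_0[OF tendsto_const] filterlim_at_top_imp_at_infinity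
        filterlim_tendsto_add_at_top[where f="\<lambda>_. - x", OF tendsto_const filterlim_ident,
          unfolded add.commute[of "- x"]]) auto
  then have l2: "((\<lambda>R. ln (R + x) - ln (R - x)) \<longlongrightarrow> 0) at_top"
  proof (rule Lim_transform_eventually[OF tendsto_eq_rhs])
    show "\<forall>\<^sub>F R in at_top. ln (1 + 2 * x / (R + - x)) = ln (R + x) - ln (R - x)"
      using eventually_gt_at_top[of x]
    proof eventually_elim
      case (elim R)
      then have "1 + 2 * x / (R + - x) = (R + x) / (R - x)" by (simp add: field_simps)
      then show ?case using elim x by (simp add: ln_div)
    qed
  qed simp
  have l3: "((\<lambda>\<epsilon>. LBINT y:{x - \<epsilon>..x + \<epsilon>}. k y) \<longlongrightarrow> 0) (at_right 0)"
    using x k_le_near by (intro set_integral_symmetric_interval_tendsto_0[where \<delta>=x and B="2 * L"] k_integrable_subset) auto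
  have l4: "((\<lambda>\<epsilon>. LBINT y:{x - \<epsilon>..x + \<epsilon>}. f y / (x + y)) \<longlongrightarrow> 0) (at_right 0)"
  proof (rule set_integral_symmetric_interval_tendsto_0[where \<delta>=x and B="M / x"])
    show "set_integrable lborel {x - x..x + x} (\<lambda>y. f y / (x + y))"
      using x by (intro borel_integrable_atLeastAtMost' continuous_intros continuous_on_subset[OF cont]) auto
    show "\<bar>f y / (x + y)\<bar> \<le> M / x" if "y \<in> {x - x..x + x}" for y
      unfolding abs_divide using that x bdd[of y] by (intro frac_le) auto
  qed (rule x)
  have "((\<lambda>z. T (fst z) (snd z)) \<longlongrightarrow> f x * ((ln (2 * x - 0) - ln (2 * x + 0)) + 0) - (I - 0 - 0) + 0) ?F"
    unfolding T_def
    by (intro tendsto_intros filterlim_compose[OF l1 fst] filterlim_compose[OF l2 snd]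
      filterlim_compose[OF l3 fst] filterlim_compose[OF k_tail_tendsto_0 snd] filterlim_compose[OF l4 fst])
  then have "((\<lambda>z. 1 / pi * T (fst z) (snd z)) \<longlongrightarrow> 1 / pi * - I) ?F"
    by (intro tendsto_intros) simp
  moreover have "\<forall>\<^sub>F z in ?F. 1 / pi * T (fst z) (snd z)
      = (case z of (\<epsilon>, R) \<Rightarrow> 1 / pi * (LBINT y:{y. \<epsilon> < \<bar>x - y\<bar> \<and> \<bar>y\<bar> < R}. f y / (x - y)))"
  proof -
    \<comment> \<open>The thresholds \<open>\<epsilon> < x\<close> and \<open>R > 2 * x\<close> are
      independent of each other and together imply \<open>x + \<epsilon> < R\<close>.\<close>
    have "\<forall>\<^sub>F \<epsilon> in at_right 0. 0 < \<epsilon> \<and> \<epsilon> < x"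
      using x by (auto intro: eventually_at_rightI)
    from eventually_prodI[OF this eventually_gt_at_top[of "2 * x"]] show ?thesis
    proof eventually_elim
      case (elim z)
      then show ?case
        using truncated_integral[of "fst z" "snd z"] by (simp add: T_def I_def case_prod_unfold)
    qed
  qed
  ultimately have "((\<lambda>(\<epsilon>, R). 1 / pi * (LBINT y:{y. \<epsilon> < \<bar>x - y\<bar> \<and> \<bar>y\<bar> < R}. f y / (x - y))) \<longlongrightarrow> 1 / pi * - I) ?F"
    by (rule Lim_transform_eventually)
  \<comment> \<open>Convergence along a nontrivial filter makes \<open>Lim\<close> the actual limit
    rather than an unspecified value.\<close>
  then show ?thesis
    unfolding hilbert_transform_def
    by (subst tendsto_Lim) (auto simp: prod_filter_eq_bot I_def)
qed

end

section \<open>The weighted inequality\<close>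

text \<open>The continuous \<open>f'\<close> is bounded on \<open>[0, 2 * x]\<close>, which gives
  the Lipschitz bound of the locale by the mean value inequality. The integral of \<open>k\<close>
  is then at least the increment, and the factor \<open>- 1 / pi\<close> reverses the
  inequality.\<close>

lemma hilbert_transform_le_increment:
  fixes f f' :: "real \<Rightarrow> real"
  assumes der: "\<And>y. (f has_real_derivative f' y) (at y)" and cont: "continuous_on UNIV f'"
    and even: "\<And>y. f (- y) = f y" and mono: "mono_on {0..} f" and bdd: "bounded (range f)"
    and x: "x > 0"
  shows "hilbert_transform f x \<le> - (f x - f (x / 2)) / pi"
proof -
  obtain M where M: "\<And>y. \<bar>f y\<bar> \<le> M"
    using bdd by (auto simp: bounded_iff)
  have "bounded (f' ` {0..2 * x})"
    by (intro compact_imp_bounded compact_continuous_image continuous_on_subset[OF cont]) auto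
  then obtain L where L: "\<And>y. y \<in> {0..2 * x} \<Longrightarrow> \<bar>f' y\<bar> \<le> L"
    unfolding bounded_iff by (metis imageI real_norm_def)
  interpret even_mono_kernel f x M L
  proof
    show "continuous_on UNIV f"
      using der by (intro continuous_at_imp_continuous_on) (auto intro: DERIV_isCont)
    show "\<bar>f y - f x\<bar> \<le> L * \<bar>y - x\<bar>" if "y \<in> {0..2 * x}" for y
      using field_differentiable_bound[of "{0..2 * x}" f f' L y x] that x L
      by (auto intro: has_field_derivative_at_within der)
  qed (fact x even mono M)+
  show ?thesis
    unfolding hilbert_transform_eq
    using increment_le_integral_k by (simp add: field_simps)
qed

theorem proposition6p4:
  fixes p \<sigma> :: real
  assumes "p \<ge> 1" and "\<sigma> > 0"
  shows "\<exists>C\<^sub>0 > 0. \<forall>f :: real \<Rightarrow> real.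
    f C1_differentiable_on UNIV \<longrightarrow> (\<forall>x. f (- x) = f x) \<longrightarrow> bounded (range f) \<longrightarrow>
    f 0 = 0 \<longrightarrow> (\<forall>x>0. deriv f x \<ge> 0) \<longrightarrow>
    - ext_integral {0<..<1}
        (\<lambda>x. hilbert_transform f x * deriv f x * f x powr (p - 1) / x powr \<sigma>)
      \<ge> ereal C\<^sub>0 * ext_integral {0<..<1} (\<lambda>x. f x powr (p + 1) / x powr (1 + \<sigma>))"
proof -
  obtain K where K: "K > 0" and hardy: "\<And>f::real \<Rightarrow> real. f \<in> borel_measurable borel \<Longrightarrow>
      mono_on {0..} f \<Longrightarrow> isCont f 0 \<Longrightarrow> f 0 = 0 \<Longrightarrow>
      (\<integral>\<^sup>+x\<in>{0<..<1}. ennreal (f x powr (p + 1) / x powr (1 + \<sigma>)) \<partial>lborel)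
      \<le> ennreal K * (\<integral>\<^sup>+x\<in>{0<..<1}. ennreal ((f x - f (x / 2)) powr (p + 1) / x powr (1 + \<sigma>)) \<partial>lborel)"
    using dyadic_hardy_inequality[of "p + 1" \<sigma>] assms by auto
  \<comment> \<open>The three factors come from the Hardy inequality (\<open>K\<close>), the
    integrated power (\<open>p + 1\<close>) and the normalisation of the Hilbert transform
    (\<open>pi\<close>).\<close>
  define C where "C = 1 / (K * (p + 1) * pi)"
  have C: "C > 0" using K assms by (simp add: C_def)
  show ?thesis
  proof (intro exI[of _ C] conjI allI impI C)
    fix f :: "real \<Rightarrow> real"
    assume C1: "f C1_differentiable_on UNIV" and even: "\<forall>x. f (- x) = f x"
      and bdd: "bounded (range f)" and f0: "f 0 = 0" and nonneg: "\<forall>x>0. deriv f x \<ge> 0"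
    obtain f' where der: "\<And>y. (f has_real_derivative f' y) (at y)" and cont: "continuous_on UNIV f'"
      using C1 by (auto simp: C1_differentiable_on_def has_real_derivative_iff_has_vector_derivative)
    have f': "deriv f = f'"
      using der by (auto intro: DERIV_imp_deriv)
    \<comment> \<open>The sign of the derivative is known only at positive points. The criterion
      used asks for it only inside the open interval, with continuity up to the endpoints.\<close>
    have mono: "mono_on {0..} f"
    proof (rule mono_onI)
      fix r s :: real assume rs: "r \<in> {0..}" "s \<in> {0..}" "r \<le> s"
      have cf: "continuous_on A f" for A
        using der by (intro continuous_at_imp_continuous_on) (auto intro: DERIV_isCont)
      show "f r \<le> f s"
      proof (rule DERIV_nonneg_imp_increasing_open[of r s f])
        show "\<exists>y. (f has_real_derivative y) (at t) \<and> 0 \<le> y" if "r < t" "t < s" for t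
          using that rs nonneg der[of t] by (auto simp: f')
      qed (use rs cf in auto)
    qed
    have [measurable]: "f' \<in> borel_measurable borel"
      by (rule borel_measurable_continuous_onI[OF cont])
    have [measurable]: "f \<in> borel_measurable borel"
      using der by (intro borel_measurable_continuous_onI continuous_at_imp_continuous_on)
        (auto intro: DERIV_isCont)
    \<comment> \<open>For \<open>p = 1\<close> the convention \<open>0 powr 0 = 0\<close> applies
      where \<open>f x = 0\<close>. At such \<open>x > 0\<close> the function has a minimum, so its
      derivative vanishes and the integrand is \<open>0\<close> under either convention.\<close>
    define G where "G x = hilbert_transform f x * deriv f x * f x powr (p - 1) / x powr \<sigma>" for x
    define H where "H x = (f x - f (x / 2)) * f' x * f x powr (p - 1) / x powr \<sigma>" for x
    have H0: "0 \<le> H x" and GH: "H x / pi \<le> - G x" if "x > 0" for x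
    proof -
      define w where "w = f' x * f x powr (p - 1) / x powr \<sigma>"
      have w: "w \<ge> 0" using nonneg that by (simp add: w_def f')
      have Hw: "H x = (f x - f (x / 2)) * w" and Gw: "G x = hilbert_transform f x * w"
        by (simp_all add: H_def G_def w_def f')
      show "0 \<le> H x"
        unfolding Hw using w mono_onD[OF mono, of "x / 2" x] that by simp
      have "hilbert_transform f x \<le> - (f x - f (x / 2)) / pi"
        using der cont even mono bdd that by (intro hilbert_transform_le_increment) auto
      from mult_right_mono[OF this w] show "H x / pi \<le> - G x"
        unfolding Hw Gw by (simp add: field_simps)
    qed
    have G0: "G x \<le> 0" if "x > 0" for x
      using GH[OF that] H0[OF that] pi_gt_zero by (smt (verit) divide_nonneg_pos)
    define lhs where "lhs = (\<integral>\<^sup>+x\<in>{0<..<1}. ennreal (- G x) \<partial>lborel)"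
    define rhs where "rhs = (\<integral>\<^sup>+x\<in>{0<..<1}. ennreal (f x powr (p + 1) / x powr (1 + \<sigma>)) \<partial>lborel)"
    define J where "J = (\<integral>\<^sup>+x\<in>{0<..<1}. ennreal (H x) \<partial>lborel)"
    have "rhs \<le> ennreal K * (\<integral>\<^sup>+x\<in>{0<..<1}. ennreal ((f x - f (x / 2)) powr (p + 1) / x powr (1 + \<sigma>)) \<partial>lborel)"
      unfolding rhs_def using mono f0 der DERIV_isCont by (intro hardy) auto
    also have "\<dots> \<le> ennreal K * (ennreal (p + 1) * J)"
      unfolding J_def H_def using assms der nonneg mono f0
      by (intro mult_left_mono nn_integral_powr_increment_le) (auto simp: f')
    finally have 1: "rhs \<le> ennreal K * (ennreal (p + 1) * J)" .
    have 2: "ennreal (1 / pi) * J \<le> lhs"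
    proof -
      have "ennreal (1 / pi) * J = (\<integral>\<^sup>+x. ennreal (1 / pi) * (ennreal (H x) * indicator {0<..<1} x) \<partial>lborel)"
        unfolding J_def by (subst nn_integral_cmult) (auto simp: H_def)
      \<comment> \<open>The comparison with \<open>- G\<close> is pure monotonicity of the
        nonnegative integral; measurability serves only to pull the constant out of the integral of
        \<open>H\<close>.\<close>
      also have "\<dots> \<le> lhs"
        unfolding lhs_def using GH
        by (intro nn_integral_mono) (auto split: split_indicator intro!: ennreal_leI simp flip: ennreal_mult')
      finally show ?thesis .
    qed
    \<comment> \<open>The chain is carried out in \<open>ennreal\<close> with \<open>C > 0\<close>,
      so it includes the infinite case: an infinite \<open>rhs\<close> forces an infinite
      \<open>lhs\<close>.\<close>
    have "ennreal C * rhs \<le> ennreal C * (ennreal K * (ennreal (p + 1) * J))"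
      using 1 by (rule mult_left_mono) simp
    also have "\<dots> = ennreal (C * K * (p + 1)) * J"
      using C K assms by (simp add: ennreal_mult' mult.assoc del: ennreal_plus)
    also have "C * K * (p + 1) = 1 / pi"
      using K assms by (simp add: C_def)
    also note 2
    finally have main: "ennreal C * rhs \<le> lhs" .
    \<comment> \<open>Since \<open>G \<le> 0\<close> on the interval, its positive part integrates
      to \<open>0\<close>. The undefined case of \<open>ext_integral\<close> cannot occur, and
      negation yields exactly \<open>lhs\<close>.\<close>
    have "(\<integral>\<^sup>+x\<in>{0<..<1}. ennreal (G x) \<partial>lborel) = (\<integral>\<^sup>+x. 0 \<partial>(lborel :: real measure))"
      using G0 by (intro nn_integral_cong) (auto simp: ennreal_neg split: split_indicator)
    then have "- ext_integral {0<..<1} G = enn2ereal lhs"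
      by (simp add: ext_integral_def lhs_def zero_ennreal.rep_eq minus_ereal_def)
    moreover have "ext_integral {0<..<1} (\<lambda>x. f x powr (p + 1) / x powr (1 + \<sigma>)) = enn2ereal rhs"
      by (simp add: ext_integral_def rhs_def ennreal_neg zero_ennreal.rep_eq)
    moreover have "ereal C * enn2ereal rhs = enn2ereal (ennreal C * rhs)"
      using C by (simp add: times_ennreal.rep_eq enn2ereal_ennreal)
    ultimately show "- ext_integral {0<..<1}
        (\<lambda>x. hilbert_transform f x * deriv f x * f x powr (p - 1) / x powr \<sigma>)
      \<ge> ereal C * ext_integral {0<..<1} (\<lambda>x. f x powr (p + 1) / x powr (1 + \<sigma>))"
      using main unfolding G_def by (simp add: less_eq_ennreal.rep_eq)
  qed
qed

end
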